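(* Let $X$ be a $T_0$ topological space. (a) $|X|\le 2^{\operatorname{ps}(X)}$. (b) $\psi w_0(X)\le 2^{<\operatorname{ps}(X)}$. In particular, if $\operatorname{ps}(X)=\omega$, then $\psi w_0(X)=\omega$ as well.
   Context: Point separating game $G_\beta(X)$ ($X$ a topological space, $\beta$ an ordinal): two players, Seeker and Hider, make $\beta$ moves. At move $\alpha<\beta$, knowing all previous moves, the Seeker chooses an open set $U_\alpha\subseteq X$, and then the Hider chooses $V_\alpha\in\{U_\alpha, X\setminus U_\alpha\}$. The outcome is $W=\bigcap_{\alpha<\beta}V_\alpha$ (with $W=X$ if $\beta=0$). The Seeker wins iff $|W|\le 1$. For a $T_0$ space $X$, the point separation number $\operatorname{ps}(X)$ is the least ordinal $\beta$ such that the Seeker has a winning strategy in $G_\beta(X)$; it need not be a cardinal. For an ordinal $\beta$, $2^{\beta}$ here denotes the cardinality of the set ${}^{\beta}2$ of functions from $\beta$ to $2$, and $2^{<\beta}=\sup\{|{}^{\alpha}2|:\alpha<\beta\}$ (a cardinal). The $T_0$-pseudoweight of a $T_0$ space $(X,\tau_X)$ is $\psi w_0(X)=\min\{w(\rho): \rho\subseteq\tau_X \text{ is a } T_0 \text{ topology on } X\}$, where $w$ denotes weight. For infinite $X$ this equals the minimum cardinality of a family of open sets of $X$ that is $T_0$-separating (for any two distinct points, some member contains exactly one of them).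
   Formalization: Part (b) is stated for infinite X only: it fails for every finite nonempty T_0 space (for one point, ps(X)=0 and 2^{<0}=0, but ψw_0(X)=1). Part (a) and the case ps(X)=ω are stated for all T_0 spaces. *)

theory Defs
  imports "HOL-Analysis.Abstract_Topological_Spaces"
begin

unbundle cardinal_syntax
(* Set_Algebras uses the same infix symbol as order isomorphism. *)
no_notation elt_set_eq (infix \<open>=o\<close> 50)

text \<open>
  Ordinals are represented, as in the HOL library of well-orders, by well-order relations \<open>r\<close>
  (with \<open>Well_order r\<close>), compared by \<open>\<le>o\<close>, \<open><o\<close>, \<open>=o\<close>; cardinals are those satisfying
  \<open>Card_order r\<close>.  The ordinals below \<open>r\<close> are, up to order isomorphism, exactly the
  initial segments \<open>Restr r (underS r a)\<close> for \<open>a \<in> Field r\<close>, so a transfinite sequence of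
  length \<open>r\<close> is a function considered on \<open>Field r\<close>.
\<close>

definition least_ord :: "'b rel set \<Rightarrow> 'b rel" where
  "least_ord R = (SOME r. r \<in> R \<and> (\<forall>s\<in>R. r \<le>o s))"

lemma least_ord:
  assumes "R \<noteq> {}" and "\<And>r. r \<in> R \<Longrightarrow> Well_order r"
  shows "least_ord R \<in> R" and "s \<in> R \<Longrightarrow> least_ord R \<le>o s"
proof -
  have "\<exists>r. r \<in> R \<and> (\<forall>s\<in>R. r \<le>o s)"
    using exists_minim_Well_order[of R] assms by blast
  then have "least_ord R \<in> R \<and> (\<forall>s\<in>R. least_ord R \<le>o s)"
    unfolding least_ord_def by (rule someI_ex)
  then show "least_ord R \<in> R" and "s \<in> R \<Longrightarrow> least_ord R \<le>o s" by auto
qed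


section \<open>The point separating game\<close>

text \<open>
  A Seeker strategy maps a stage and the history of all earlier moves (of both players) to an
  open set.  Histories at stage \<open>a\<close> are the restrictions of plays to the earlier stages
  \<open>underS r a\<close>, so the strategy cannot see the present or future moves.
\<close>

definition history ::
  "'b rel \<Rightarrow> ('b \<Rightarrow> 'a set) \<Rightarrow> ('b \<Rightarrow> 'a set) \<Rightarrow> 'b \<Rightarrow> ('b \<Rightarrow> 'a set \<times> 'a set)" where
  "history r U V a = restrict (\<lambda>c. (U c, V c)) (underS r a)"

definition seeker_strategy ::
  "'a topology \<Rightarrow> 'b rel \<Rightarrow> ('b \<Rightarrow> ('b \<Rightarrow> 'a set \<times> 'a set) \<Rightarrow> 'a set) \<Rightarrow> bool" where
  "seeker_strategy X r \<sigma> \<longleftrightarrow> (\<forall>a\<in>Field r. \<forall>h. openin X (\<sigma> a h))"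

definition game_play ::
  "'a topology \<Rightarrow> 'b rel \<Rightarrow> ('b \<Rightarrow> 'a set) \<Rightarrow> ('b \<Rightarrow> 'a set) \<Rightarrow> bool" where
  "game_play X r U V \<longleftrightarrow>
     (\<forall>a\<in>Field r. openin X (U a) \<and> V a \<in> {U a, topspace X - U a})"

definition follows ::
  "'b rel \<Rightarrow> ('b \<Rightarrow> ('b \<Rightarrow> 'a set \<times> 'a set) \<Rightarrow> 'a set) \<Rightarrow>
   ('b \<Rightarrow> 'a set) \<Rightarrow> ('b \<Rightarrow> 'a set) \<Rightarrow> bool" where
  "follows r \<sigma> U V \<longleftrightarrow> (\<forall>a\<in>Field r. U a = \<sigma> a (history r U V a))"

text \<open>Intersecting with \<open>topspace X\<close> makes the outcome the whole space for length 0.\<close>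

definition outcome :: "'a topology \<Rightarrow> 'b rel \<Rightarrow> ('b \<Rightarrow> 'a set) \<Rightarrow> 'a set" where
  "outcome X r V = topspace X \<inter> (\<Inter>a\<in>Field r. V a)"

definition winning_seeker_strategy ::
  "'a topology \<Rightarrow> 'b rel \<Rightarrow> ('b \<Rightarrow> ('b \<Rightarrow> 'a set \<times> 'a set) \<Rightarrow> 'a set) \<Rightarrow> bool" where
  "winning_seeker_strategy X r \<sigma> \<longleftrightarrow>
     seeker_strategy X r \<sigma> \<and>
     (\<forall>U V. game_play X r U V \<and> follows r \<sigma> U V \<longrightarrow>
        finite (outcome X r V) \<and> card (outcome X r V) \<le> 1)"

definition seeker_wins :: "'a topology \<Rightarrow> 'b rel \<Rightarrow> bool" where
  "seeker_wins X r \<longleftrightarrow> (\<exists>\<sigma>. winning_seeker_strategy X r \<sigma>)"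

text \<open>
  The minimum is taken over well-orders on the type of subsets of the space.  This type is large
  enough: lemma \<open>ps_least\<close> below shows that the value is least among well-orders on any type.
\<close>

definition ps :: "'a topology \<Rightarrow> 'a set rel" where
  "ps X = least_ord {r. Well_order r \<and> seeker_wins X r}"

lemma seeker_wins_enumerate:
  assumes "t0_space X" and r: "well_order_on {U. openin X U} r"
  shows "seeker_wins X r"
proof -
  have F: "Field r = {U. openin X U}"
    using r well_order_on_Field by blast
  have "winning_seeker_strategy X r (\<lambda>a h. a)"
    unfolding winning_seeker_strategy_def seeker_strategy_def
  proof (intro conjI allI impI ballI)
    show "openin X a" if "a \<in> Field r" for a
      using that F by simp
  next
    fix U V
    assume *: "game_play X r U V \<and> follows r (\<lambda>a h. a) U V"
    have V: "V A = A \<or> V A = topspace X - A" if "openin X A" for A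
      using * that F unfolding game_play_def follows_def by auto
    have "x = y" if "x \<in> outcome X r V" "y \<in> outcome X r V" for x y
    proof (rule ccontr)
      assume "x \<noteq> y"
      moreover have "x \<in> topspace X" "y \<in> topspace X"
        using that by (auto simp: outcome_def)
      ultimately obtain A where A: "openin X A" "x \<in> A \<longleftrightarrow> y \<notin> A"
        using \<open>t0_space X\<close> unfolding t0_space_def by metis
      have "x \<in> V A" "y \<in> V A"
        using that A F by (auto simp: outcome_def)
      then show False
        using V[OF A(1)] A(2) by auto
    qed
    then have "outcome X r V = {} \<or> (\<exists>x. outcome X r V = {x})"
      by blast
    then show "finite (outcome X r V)" "card (outcome X r V) \<le> 1"
      by auto
  qed
  then show ?thesis
    unfolding seeker_wins_def by blast
qed

lemma seeker_wins_ordIso: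
  fixes r :: "'b rel" and r' :: "'c rel"
  assumes "seeker_wins X r" and "r =o r'"
  shows "seeker_wins X r'"
proof -
  obtain f where "iso r r' f"
    using \<open>r =o r'\<close> unfolding ordIso_def by auto
  then have bij: "bij_betw f (Field r) (Field r')"
    and ord: "\<And>a b. a \<in> Field r \<Longrightarrow> b \<in> Field r \<Longrightarrow> (a, b) \<in> r \<longleftrightarrow> (f a, f b) \<in> r'"
    by (auto simp: iso_iff2)
  define g where "g = inv_into (Field r) f"
  have gf: "g (f a) = a" if "a \<in> Field r" for a
    using bij that by (simp add: g_def bij_betw_inv_into_left)
  have f_img: "f ` Field r = Field r'"
    using bij by (simp add: bij_betw_def)
  have under: "f c \<in> underS r' (f a)" if "a \<in> Field r" "c \<in> underS r a" for a c
  proof -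
    have "c \<in> Field r" "(c, a) \<in> r" "c \<noteq> a"
      using that by (auto simp: underS_def Field_def)
    then show ?thesis
      using that(1) ord bij by (auto simp: underS_def bij_betw_def inj_on_def)
  qed
  obtain \<sigma> where \<sigma>: "winning_seeker_strategy X r \<sigma>"
    using assms(1) unfolding seeker_wins_def by blast
  define \<sigma>' where "\<sigma>' = (\<lambda>a h. \<sigma> (g a) (restrict (h \<circ> f) (underS r (g a))))"
  have "winning_seeker_strategy X r' \<sigma>'"
    unfolding winning_seeker_strategy_def
  proof (intro conjI allI impI)
    have "g a \<in> Field r" if "a \<in> Field r'" for a
      using that f_img gf by (metis imageE)
    then show "seeker_strategy X r' \<sigma>'"
      using \<sigma> unfolding winning_seeker_strategy_def seeker_strategy_def \<sigma>'_def by blast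
  next
    fix U V
    assume *: "game_play X r' U V \<and> follows r' \<sigma>' U V"
    have "game_play X r (U \<circ> f) (V \<circ> f)"
      using * f_img unfolding game_play_def by auto
    moreover have "follows r \<sigma> (U \<circ> f) (V \<circ> f)"
      unfolding follows_def
    proof
      fix a assume a: "a \<in> Field r"
      have "U (f a) = \<sigma>' (f a) (history r' U V (f a))"
        using * a f_img unfolding follows_def by auto
      also have "\<dots> = \<sigma> a (restrict (history r' U V (f a) \<circ> f) (underS r a))"
        by (simp add: \<sigma>'_def gf[OF a])
      also have "restrict (history r' U V (f a) \<circ> f) (underS r a) = history r (U \<circ> f) (V \<circ> f) a"
        using under[OF a] by (auto simp: history_def restrict_def fun_eq_iff)
      finally show "(U \<circ> f) a = \<sigma> a (history r (U \<circ> f) (V \<circ> f) a)"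
        by simp
    qed
    moreover have "outcome X r (V \<circ> f) = outcome X r' V"
      unfolding outcome_def f_img[symmetric] by simp
    ultimately show "finite (outcome X r' V)" "card (outcome X r' V) \<le> 1"
      using \<sigma> unfolding winning_seeker_strategy_def by metis+
  qed
  then show ?thesis
    unfolding seeker_wins_def by blast
qed

lemma ps:
  assumes "t0_space X"
  shows "Well_order (ps X)" and "seeker_wins X (ps X)"
proof -
  obtain r where r: "well_order_on {U. openin X U} r"
    using well_order_on by blast
  then have "Well_order r"
    using well_order_on_Well_order by blast
  then have "{r :: 'a set rel. Well_order r \<and> seeker_wins X r} \<noteq> {}"
    using seeker_wins_enumerate[OF assms r] by blast
  from least_ord(1)[OF this] show "Well_order (ps X)" "seeker_wins X (ps X)"
    by (auto simp: ps_def)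
qed

lemma ps_least:
  fixes s :: "'b rel"
  assumes "t0_space X" and "Well_order s" and "seeker_wins X s"
  shows "ps X \<le>o s"
proof (rule ccontr)
  assume "\<not> ps X \<le>o s"
  then have "s <o ps X"
    using ps(1)[OF assms(1)] assms(2) not_ordLeq_iff_ordLess by blast
  then obtain p :: "'a set rel" where p: "s =o p" "p <o ps X"
    using internalize_ordLess[of s "ps X"] by auto
  have "Well_order p"
    using p(1) unfolding ordIso_def by auto
  moreover have "seeker_wins X p"
    by (rule seeker_wins_ordIso[OF assms(3) p(1)])
  ultimately have p': "p \<in> {r. Well_order r \<and> seeker_wins X r}"
    by simp
  have "ps X \<le>o p"
    unfolding ps_def by (rule least_ord(2)[OF _ _ p']) (use p' in auto)
  with p(2) show False
    using not_ordLess_ordLeq by blast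
qed


section \<open>Weak powers and pseudoweight\<close>

text \<open>
  For a well-order \<open>r\<close>, not necessarily a cardinal, the library's \<open>ctwo ^c r\<close> is by definition the
  cardinality of the set of functions from \<open>Field r\<close> to \<open>bool\<close>, so it is the size of the function
  set and not an ordinal power.  The supremum over the ordinals below \<open>r\<close> is the least cardinal
  bounding all \<open>ctwo ^c s\<close>; being at most \<open>ctwo ^c r\<close>, it is represented on the type of the latter.
\<close>

definition two_pow_less :: "'b rel \<Rightarrow> ('b \<Rightarrow> bool) rel" where
  "two_pow_less r =
     least_ord {k. Card_order k \<and> (\<forall>a\<in>Field r. ctwo ^c Restr r (underS r a) \<le>o k)}"

definition base_of_topology :: "'a topology \<Rightarrow> 'a set set \<Rightarrow> bool" where
  "base_of_topology X B \<longleftrightarrow> openin X = arbitrary union_of (\<lambda>V. V \<in> B)"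

definition weight :: "'a topology \<Rightarrow> 'a set rel" where
  "weight X = least_ord {|B| | B. base_of_topology X B}"

text \<open>
  Weight is the least size of a base, with no lower bound \<open>\<omega>\<close> imposed.  For a finite nonempty T0 space
  with \<open>m\<close> points the pseudoweight is \<open>m\<close> and \<open>ps\<close> is \<open>n = \<lceil>log\<^sub>2 m\<rceil>\<close>, so it exceeds \<open>2\<^sup><\<^sup>n\<close>;
  bounding it by \<open>two_pow_less\<close> is meaningful for infinite spaces only.
\<close>

definition t0_pseudoweight :: "'a topology \<Rightarrow> 'a set rel" where
  "t0_pseudoweight X =
     least_ord {weight Y | Y. topspace Y = topspace X \<and> (\<forall>U. openin Y U \<longrightarrow> openin X U) \<and> t0_space Y}"

end

(*
  Fix a winning Seeker strategy and let the Hider always keep a given point x.  In the resulting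
  play the only survivor is x, and the Seeker's move at stage a depends only on the answers to
  "is x in the current open set?" at the stages before a.  So x is determined by its
  full sequence of answers, which gives (a).  The open sets met in all these plays separate points,
  and there are at most 2^|a| of them at stage a.  Since the game has at most 2^{<ps} stages,
  summing over the stages gives (b) once finite intersections are taken.
*)

theory Submission
  imports Defs
begin

section \<open>Cardinal bounds\<close>

text \<open>On \<open>A\<close> the map \<open>h\<close> factors through \<open>c\<close>: choosing
  a preimage of each code recovers the value of \<open>h\<close>. Later \<open>c\<close> is the
  sequence of earlier answers and \<open>h\<close> the Seeker's move.\<close>

lemma card_of_image_ordLeq_image:
  assumes "\<And>x y. x \<in> A \<Longrightarrow> y \<in> A \<Longrightarrow> c x = c y \<Longrightarrow> h x = h y"
  shows "|h ` A| \<le>o |c ` A|"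
proof -
  have "h x = h (inv_into A c (c x))" if "x \<in> A" for x
    using that by (intro assms) (auto simp: inv_into_into f_inv_into_f)
  then have "h ` A = (\<lambda>z. h (inv_into A c z)) ` c ` A"
    by (force simp: image_image)
  then show ?thesis
    by (metis card_of_image)
qed

text \<open>The finite subsets split into countably many layers by size. Adding one element makes
  each layer an image of \<open>A\<close> times the previous one, so an infinite \<open>k\<close>
  bounds every layer and their union.\<close>

lemma card_of_Fpow_ordLeq_infinite_Field:
  assumes k: "Card_order k" "infinite (Field k)" and A: "|A| \<le>o k"
  shows "|Fpow A| \<le>o k"
proof -
  define F where "F n = {S. S \<subseteq> A \<and> finite S \<and> card S = n}" for n
  have F_bound: "|F n| \<le>o k" for n
  proof (induction n)
    case 0
    have "F 0 = {{}}"
      by (auto simp: F_def)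
    then show ?case
      using k by (metis Card_order_singl_ordLeq finite.emptyI)
  next
    case (Suc n)
    have "F (Suc n) \<subseteq> (\<lambda>(a, S). insert a S) ` (A \<times> F n)"
    proof
      fix S assume S: "S \<in> F (Suc n)"
      then have "card S = Suc n" "S \<subseteq> A" "finite S"
        by (auto simp: F_def)
      then obtain a T where "S = insert a T" "a \<notin> T" "card T = n"
        by (metis card_Suc_eq)
      then show "S \<in> (\<lambda>(a, S). insert a S) ` (A \<times> F n)"
        using \<open>S \<subseteq> A\<close> \<open>finite S\<close> by (force simp: F_def)
    qed
    then have "|F (Suc n)| \<le>o |A \<times> F n|"
      by (rule surj_imp_ordLeq)
    moreover have "|A \<times> F n| \<le>o k"
      using k A Suc by (intro card_of_Times_ordLeq_infinite_Field)
    ultimately show ?case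
      using ordLeq_transitive by blast
  qed
  have "|UNIV :: nat set| \<le>o k"
    using k by (metis infinite_iff_card_of_nat card_of_Field_ordIso ordLeq_ordIso_trans)
  then have "|\<Union>n\<in>UNIV. F n| \<le>o k"
    using k F_bound by (intro card_of_UNION_ordLeq_infinite_Field) auto
  moreover have "Fpow A = (\<Union>n\<in>UNIV. F n)"
    by (auto simp: F_def Fpow_def)
  ultimately show ?thesis
    by simp
qed

lemma Field_Restr_underS:
  assumes "Well_order r"
  shows "Field (Restr r (underS r a)) = underS r a"
  using assms by (simp add: wo_rel_def wo_rel.underS_ofilter Field_Restr_ofilter)

lemma ctwo_cexp_eq: "ctwo ^c r = |Func (Field r) (UNIV :: bool set)|"
  by (simp add: cexp_def ctwo_def Field_card_of)

lemma finite_Func_bool: "finite A \<Longrightarrow> finite (Func A (UNIV :: bool set))"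
  by (metis card_of_Pow_Func card_of_ordIso_finite finite_Pow_iff)

text \<open>The full power \<open>ctwo ^c r\<close> is itself a bound, so the minimum defining
  \<open>two_pow_less\<close> exists on the type \<open>'b => bool\<close>.\<close>

lemma two_pow_less_bounds_nonempty:
  assumes "Well_order r"
  shows "{k :: ('b \<Rightarrow> bool) rel. Card_order k \<and>
    (\<forall>a\<in>Field (r :: 'b rel). ctwo ^c Restr r (underS r a) \<le>o k)} \<noteq> {}"
proof -
  have "ctwo ^c Restr r (underS r a) \<le>o ctwo ^c r" for a
  proof -
    \<comment> \<open>Passing to power sets reduces monotonicity in the exponent to an
      inclusion.\<close>
    have "|Func (underS r a) (UNIV :: bool set)| =o |Pow (underS r a)|"
      using card_of_Pow_Func ordIso_symmetric by blast
    also have "|Pow (underS r a)| \<le>o |Pow (Field r)|"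
      by (rule card_of_mono1) (auto simp: underS_def Field_def)
    also have "|Pow (Field r)| =o |Func (Field r) (UNIV :: bool set)|"
      by (rule card_of_Pow_Func)
    finally show ?thesis
      by (simp add: ctwo_cexp_eq Field_Restr_underS[OF assms])
  qed
  moreover have "Card_order (ctwo ^c r)"
    by (rule Card_order_cexp)
  ultimately show ?thesis
    by blast
qed

lemma two_pow_less:
  assumes "Well_order r"
  shows "Card_order (two_pow_less r)"
    and "a \<in> Field r \<Longrightarrow> ctwo ^c Restr r (underS r a) \<le>o two_pow_less r"
  using least_ord(1)[OF two_pow_less_bounds_nonempty[OF assms]] unfolding two_pow_less_def
  by (auto simp: card_order_on_well_order_on)

text \<open>By definition \<open>two_pow_less\<close> is least only among cardinals on one type. A
  strictly smaller bound on any type would have an isomorphic copy on that type, contradicting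
  minimality there.\<close>

lemma two_pow_less_least:
  fixes r :: "'b rel" and k :: "'c rel"
  assumes r: "Well_order r" and k: "Card_order k"
    and bound: "\<And>a. a \<in> Field r \<Longrightarrow> ctwo ^c Restr r (underS r a) \<le>o k"
  shows "two_pow_less r \<le>o k"
proof (rule ccontr)
  assume "\<not> two_pow_less r \<le>o k"
  then have "k <o two_pow_less r"
    using two_pow_less(1)[OF r] k by (metis not_ordLeq_iff_ordLess card_order_on_well_order_on)
  then obtain p :: "('b \<Rightarrow> bool) rel" where p: "k =o p" "p <o two_pow_less r"
    using internalize_ordLess[of k "two_pow_less r"] by blast
  have "Card_order p"
    using k p(1) by (metis Card_order_ordIso2)
  moreover have "ctwo ^c Restr r (underS r a) \<le>o p" if "a \<in> Field r" for a
    using bound[OF that] p(1) by (rule ordLeq_ordIso_trans)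
  ultimately have "two_pow_less r \<le>o p"
    unfolding two_pow_less_def
    by (intro least_ord(2)[OF two_pow_less_bounds_nonempty[OF r]]) (auto simp: card_order_on_well_order_on)
  with p(2) show False
    using not_ordLess_ordLeq by blast
qed

text \<open>If \<open>\<kappa> = 2\<^sup><\<^sup>r\<close> were below the length \<open>r\<close>, then \<open>2\<^sup>\<kappa>\<close> would be one of the powers bounded by \<open>\<kappa>\<close>.\<close>

lemma card_of_Field_ordLeq_two_pow_less:
  assumes r: "Well_order r"
  shows "|Field r| \<le>o two_pow_less r"
proof (rule ccontr)
  let ?k = "two_pow_less r"
  have k: "Card_order ?k" "Well_order ?k"
    using two_pow_less(1)[OF r] by (auto simp: card_order_on_well_order_on)
  assume "\<not> |Field r| \<le>o ?k"
  then have "?k <o |Field r|"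
    using k by (metis not_ordLeq_iff_ordLess card_of_Well_order)
  \<comment> \<open>\<open>|Field r|\<close> is the shortest well-order of \<open>Field r\<close>,
    so \<open>?k\<close> is shorter than \<open>r\<close> and hence isomorphic to the segment below
    some stage of \<open>r\<close>.\<close>
  then have "?k <o r"
    using card_of_least[of "Field r" r] r ordLess_ordLeq_trans by auto
  then obtain a where a: "a \<in> Field r" "?k =o Restr r (underS r a)"
    using ordLess_iff_ordIso_Restr[OF r k(2)] by blast
  have "|Field ?k| =o |underS r a|"
    using card_of_cong[OF a(2)] by (simp add: Field_Restr_underS[OF r])
  have "?k =o |Field ?k|"
    using k(1) card_of_Field_ordIso ordIso_symmetric by blast
  also have "|Field ?k| =o |underS r a|"
    by fact
  also have "|underS r a| <o |Pow (underS r a)|"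
    by (rule card_of_Pow)
  also have "|Pow (underS r a)| =o ctwo ^c Restr r (underS r a)"
    by (simp add: ctwo_cexp_eq Field_Restr_underS[OF r] card_of_Pow_Func)
  also have "ctwo ^c Restr r (underS r a) \<le>o ?k"
    by (rule two_pow_less(2)[OF r a(1)])
  finally show False
    using not_ordLess_ordLeq k(2) ordLeq_reflexive by blast
qed

text \<open>Every proper initial segment of an order of type omega is finite, and so is its set of
  0-1 sequences.\<close>

lemma two_pow_less_natLeq:
  assumes r: "Well_order r" and "r =o natLeq"
  shows "two_pow_less r \<le>o natLeq"
proof (rule two_pow_less_least[OF r natLeq_Card_order])
  fix a assume a: "a \<in> Field r"
  have less: "Restr r (underS r a) <o r"
    using a r by (intro underS_Restr_ordLess) auto
  then have "well_order_on (underS r a) (Restr r (underS r a))"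
    using Field_Restr_underS[OF r, of a] by (simp add: ordLess_def)
  then have "|underS r a| \<le>o Restr r (underS r a)"
    by (rule card_of_least)
  also note less
  also note assms(2)
  finally have "|underS r a| <o natLeq" .
  then have "finite (Func (underS r a) (UNIV :: bool set))"
    by (simp add: finite_iff_ordLess_natLeq[symmetric] finite_Func_bool)
  then show "ctwo ^c Restr r (underS r a) \<le>o natLeq"
    by (simp add: ctwo_cexp_eq Field_Restr_underS[OF r] finite_iff_ordLess_natLeq ordLess_imp_ordLeq)
qed


section \<open>Weight and pseudoweight\<close>

lemma base_of_topology_openin: "base_of_topology Y {U. openin Y U}"
  unfolding base_of_topology_def openin_topology_base_unique by auto

lemma weight:
  obtains B where "base_of_topology Y B" and "weight Y = |B|"
proof -
  have "weight Y \<in> {|B| | B. base_of_topology Y B}"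
    unfolding weight_def using base_of_topology_openin card_of_Well_order by (intro least_ord(1)) blast+
  then show thesis
    using that by blast
qed

lemma weight_ordLeq: "base_of_topology Y B \<Longrightarrow> weight Y \<le>o |B|"
  unfolding weight_def using card_of_Well_order by (intro least_ord(2)) blast+

lemma Well_order_weight: "Well_order (weight Y)"
  by (metis weight card_of_Well_order)

lemma t0_pseudoweight_ordLeq:
  assumes "topspace Y = topspace X" "\<And>U. openin Y U \<Longrightarrow> openin X U" "t0_space Y"
  shows "t0_pseudoweight X \<le>o weight Y"
  unfolding t0_pseudoweight_def
  using assms Well_order_weight by (intro least_ord(2)) blast+

lemma t0_pseudoweight:
  assumes "t0_space X"
  obtains Y where "topspace Y = topspace X" "t0_space Y" "t0_pseudoweight X = weight Y"
proof -
  let ?R = "{weight Y | Y. topspace Y = topspace X \<and> (\<forall>U. openin Y U \<longrightarrow> openin X U) \<and> t0_space Y}"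
  have "t0_pseudoweight X \<in> ?R"
    unfolding t0_pseudoweight_def
    using assms Well_order_weight by (intro least_ord(1)) blast+
  then show thesis
    using that by blast
qed

text \<open>In a T0 space a point is determined by the base members containing it, so the points
  inject into the power set of any base.\<close>

lemma infinite_base_of_t0_space:
  assumes "t0_space Y" "infinite (topspace Y)" "base_of_topology Y B"
  shows "infinite B"
proof
  assume "finite B"
  have "inj_on (\<lambda>x. {U \<in> B. x \<in> U}) (topspace Y)"
  proof (rule inj_onI, rule ccontr)
    fix x y
    assume xy: "x \<in> topspace Y" "y \<in> topspace Y" "{U \<in> B. x \<in> U} = {U \<in> B. y \<in> U}" "x \<noteq> y"
    then obtain U where U: "openin Y U" "x \<notin> U \<longleftrightarrow> y \<in> U"
      using assms(1) unfolding t0_space_def by blast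
    \<comment> \<open>Applied to whichever of \<open>x\<close>, \<open>y\<close> lies in
      \<open>U\<close>: a base member around it inside \<open>U\<close> misses the other
      point.\<close>
    moreover have "\<exists>V. V \<in> B \<and> z \<in> V \<and> V \<subseteq> U" if "z \<in> U" for z
      using assms(3) U(1) that unfolding base_of_topology_def openin_topology_base_unique by blast
    ultimately show False
      using xy(3) by blast
  qed
  moreover have "(\<lambda>x. {U \<in> B. x \<in> U}) ` topspace Y \<subseteq> Pow B"
    by auto
  ultimately have "finite (topspace Y)"
    using \<open>finite B\<close> by (meson finite_Pow_iff inj_on_finite)
  with assms(2) show False
    by simp
qed

lemma natLeq_ordLeq_t0_pseudoweight:
  assumes "t0_space X" "infinite (topspace X)"
  shows "natLeq \<le>o t0_pseudoweight X"
proof -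
  obtain Y where Y: "topspace Y = topspace X" "t0_space Y" "t0_pseudoweight X = weight Y"
    using t0_pseudoweight[OF assms(1)] by blast
  obtain B where B: "base_of_topology Y B" "weight Y = |B|"
    using weight by blast
  then have "infinite B"
    using infinite_base_of_t0_space Y assms(2) by metis
  then show ?thesis
    using Y(3) B(2) infinite_iff_natLeq_ordLeq by metis
qed

text \<open>The separating family serves as a subbase of a coarser T0 topology. Its finite
  intersections form a base, still of size at most \<open>k\<close> because \<open>k\<close> is
  infinite.\<close>

lemma t0_pseudoweight_separating:
  assumes k: "Card_order k" "infinite (Field k)" and B: "|B| \<le>o k"
    and "\<And>U. U \<in> B \<Longrightarrow> openin X U"
    and sep: "\<And>x y. x \<in> topspace X \<Longrightarrow> y \<in> topspace X \<Longrightarrow> x \<noteq> y \<Longrightarrow> \<exists>U\<in>B. x \<in> U \<longleftrightarrow> y \<notin> U"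
  shows "t0_pseudoweight X \<le>o k"
proof -
  \<comment> \<open>Intersecting with \<open>topspace X\<close> keeps the space unchanged even if
    \<open>B\<close> does not cover it; the empty intersection then yields
    \<open>topspace X\<close>.\<close>
  define P where "P = (finite intersection_of (\<lambda>U. U \<in> B) relative_to topspace X)"
  define Y where "Y = topology (arbitrary union_of P)"
  have Y: "openin Y = arbitrary union_of P"
    unfolding Y_def P_def by (rule ext) (rule openin_subbase)
  have "P (topspace X \<inter> U)" if "U \<in> B" for U
    using that unfolding P_def by (intro relative_to_inc finite_intersection_of_inc)
  then have openB: "openin Y (topspace X \<inter> U)" if "U \<in> B" for U
    using that unfolding Y by (intro arbitrary_union_of_inc)
  have topspaceY: "topspace Y = topspace X"
    unfolding Y_def P_def by (rule topspace_subbase)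
  moreover have "openin X U" if "openin Y U" for U
    using assms(4) openin_topspace that[unfolded Y_def P_def] by (rule minimal_topology_subbase)
  moreover have "t0_space Y"
    unfolding t0_space_def
  proof (intro ballI impI)
    fix x y
    assume xy: "x \<in> topspace Y" "y \<in> topspace Y" "x \<noteq> y"
    then obtain U where "U \<in> B" "x \<in> U \<longleftrightarrow> y \<notin> U"
      using sep topspaceY by metis
    then show "\<exists>U. openin Y U \<and> (x \<notin> U \<longleftrightarrow> y \<in> U)"
      using openB xy topspaceY by blast
  qed
  ultimately have "t0_pseudoweight X \<le>o weight Y"
    by (rule t0_pseudoweight_ordLeq)
  also have "weight Y \<le>o |Collect P|"
    by (rule weight_ordLeq) (simp add: base_of_topology_def Y)
  also have "|Collect P| \<le>o |Fpow B|"
  proof (rule surj_imp_ordLeq)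
    show "Collect P \<subseteq> (\<lambda>F. topspace X \<inter> \<Inter>F) ` Fpow B"
      by (auto simp: P_def relative_to_def intersection_of_def Fpow_def)
  qed
  also have "|Fpow B| \<le>o k"
    by (rule card_of_Fpow_ordLeq_infinite_Field[OF k B])
  finally show ?thesis .
qed


section \<open>The play following a point\<close>

definition hider_side :: "'a topology \<Rightarrow> 'a \<Rightarrow> 'a set \<Rightarrow> 'a set" where
  "hider_side X x U = (if x \<in> U then U else topspace X - U)"

text \<open>The play in which the Hider always keeps \<open>x\<close>, built by well-founded
  recursion along \<open>r\<close> since each move consults all earlier moves and replies.\<close>

definition seeker_moves ::
  "'a topology \<Rightarrow> 'b rel \<Rightarrow> ('b \<Rightarrow> ('b \<Rightarrow> 'a set \<times> 'a set) \<Rightarrow> 'a set) \<Rightarrow> 'a \<Rightarrow> 'b \<Rightarrow> 'a set" where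
  "seeker_moves X r \<sigma> x = wo_rel.worec r (\<lambda>U a. \<sigma> a (history r U (hider_side X x \<circ> U) a))"

lemma seeker_moves_rec:
  assumes "Well_order r"
  shows "seeker_moves X r \<sigma> x a =
    \<sigma> a (history r (seeker_moves X r \<sigma> x) (hider_side X x \<circ> seeker_moves X r \<sigma> x) a)"
proof -
  have wo: "wo_rel r"
    using assms by (simp add: wo_rel_def)
  \<comment> \<open>The recursion is admissible because \<open>history\<close> restricts to the
    stages strictly before \<open>a\<close>.\<close>
  have "wo_rel.adm_wo r (\<lambda>U a. \<sigma> a (history r U (hider_side X x \<circ> U) a))"
    unfolding wo_rel.adm_wo_def[OF wo]
    by (auto simp: history_def intro!: arg_cong[where f = "\<sigma> _"] restrict_ext)
  from wo_rel.worec_fixpoint[OF wo this] show ?thesis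
    unfolding seeker_moves_def by (rule fun_cong)
qed

lemma seeker_moves_play:
  assumes r: "Well_order r" and \<sigma>: "seeker_strategy X r \<sigma>" and x: "x \<in> topspace X"
  defines "U \<equiv> seeker_moves X r \<sigma> x"
  shows "game_play X r U (hider_side X x \<circ> U)"
    and "follows r \<sigma> U (hider_side X x \<circ> U)"
    and "x \<in> outcome X r (hider_side X x \<circ> U)"
proof -
  show fol: "follows r \<sigma> U (hider_side X x \<circ> U)"
    unfolding follows_def U_def by (intro ballI seeker_moves_rec[OF r])
  have "openin X (U a)" if "a \<in> Field r" for a
    unfolding U_def by (subst seeker_moves_rec[OF r]) (use \<sigma> that in \<open>simp add: seeker_strategy_def\<close>)
  then show "game_play X r U (hider_side X x \<circ> U)"
    by (auto simp: game_play_def hider_side_def)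
  show "x \<in> outcome X r (hider_side X x \<circ> U)"
    using x by (auto simp: outcome_def hider_side_def)
qed

text \<open>By induction on stages, equal earlier answers produce equal earlier open sets and
  replies. The two histories then coincide, and the strategy sees nothing else.\<close>

lemma seeker_moves_cong:
  assumes r: "Well_order r"
    and "\<And>c. c \<in> underS r a \<Longrightarrow> x \<in> seeker_moves X r \<sigma> x c \<longleftrightarrow> y \<in> seeker_moves X r \<sigma> y c"
  shows "seeker_moves X r \<sigma> x a = seeker_moves X r \<sigma> y a"
  using assms(2)
proof (induction a rule: wo_rel.well_order_induct[of r])
  case 1
  then show ?case
    using r by (simp add: wo_rel_def)
next
  case (2 a)
  \<comment> \<open>Stages before \<open>c\<close> are also before \<open>a\<close>, so the
    agreement of answers is inherited and the induction hypothesis applies.\<close>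
  have eq: "seeker_moves X r \<sigma> x c = seeker_moves X r \<sigma> y c" if c: "c \<in> underS r a" for c
  proof -
    have "trans r" "antisym r"
      using r by (auto simp: order_on_defs)
    then have "d \<in> underS r a" if "d \<in> underS r c" for d
      using c that unfolding underS_def by (blast dest: transD antisymD)
    then show ?thesis
      using 2 c by (auto simp: underS_def)
  qed
  have "history r (seeker_moves X r \<sigma> x) (hider_side X x \<circ> seeker_moves X r \<sigma> x) a
    = history r (seeker_moves X r \<sigma> y) (hider_side X y \<circ> seeker_moves X r \<sigma> y) a"
    unfolding history_def
  proof (rule restrict_ext)
    fix c assume "c \<in> underS r a"
    then show "(seeker_moves X r \<sigma> x c, (hider_side X x \<circ> seeker_moves X r \<sigma> x) c) =
      (seeker_moves X r \<sigma> y c, (hider_side X y \<circ> seeker_moves X r \<sigma> y) c)"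
      \<comment> \<open>For a given open set, the reply depends on the point only through
        membership.\<close>
      using eq[of c] 2(2)[of c] by (simp add: hider_side_def)
  qed
  then show ?case
    by (simp only: seeker_moves_rec[OF r, of X \<sigma> x a] seeker_moves_rec[OF r, of X \<sigma> y a])
qed

text \<open>The play keeping \<open>x\<close> is won by the Seeker and leaves \<open>x\<close> in
  the outcome, so \<open>y\<close> is discarded at some stage; the open set played there separates
  the two points.\<close>

lemma seeker_moves_separate:
  assumes r: "Well_order r" and \<sigma>: "winning_seeker_strategy X r \<sigma>"
    and xy: "x \<in> topspace X" "y \<in> topspace X" "x \<noteq> y"
  obtains a where "a \<in> Field r" "x \<in> seeker_moves X r \<sigma> x a \<longleftrightarrow> y \<notin> seeker_moves X r \<sigma> x a"
proof -
  let ?U = "seeker_moves X r \<sigma> x"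
  let ?W = "outcome X r (hider_side X x \<circ> ?U)"
  have strat: "seeker_strategy X r \<sigma>"
    using \<sigma> by (simp add: winning_seeker_strategy_def)
  note play = seeker_moves_play[OF r strat xy(1)]
  have "finite ?W" "card ?W \<le> 1"
    using \<sigma> play(1,2) unfolding winning_seeker_strategy_def by blast+
  then have "y \<notin> ?W"
    using play(3) xy(3) by (metis One_nat_def card_le_Suc0_iff_eq)
  then obtain a where "a \<in> Field r" "y \<notin> hider_side X x (?U a)"
    using xy(2) by (auto simp: outcome_def)
  then show thesis
    using that xy(2) by (auto simp: hider_side_def split: if_splits)
qed

text \<open>The answer sequence of \<open>x\<close> on the stages in \<open>S\<close>. Outside
  \<open>S\<close> it is \<open>undefined\<close>, as membership in \<open>Func S UNIV\<close>
  requires.\<close>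

definition membership_code ::
  "'a topology \<Rightarrow> 'b rel \<Rightarrow> ('b \<Rightarrow> ('b \<Rightarrow> 'a set \<times> 'a set) \<Rightarrow> 'a set) \<Rightarrow> 'b set \<Rightarrow> 'a \<Rightarrow> 'b \<Rightarrow> bool" where
  "membership_code X r \<sigma> S x = restrict (\<lambda>c. x \<in> seeker_moves X r \<sigma> x c) S"

lemma membership_code_in_Func: "membership_code X r \<sigma> S x \<in> Func S UNIV"
  by (simp add: membership_code_def Func_def)

lemma membership_code_eqD:
  "membership_code X r \<sigma> S x = membership_code X r \<sigma> S y \<Longrightarrow> c \<in> S \<Longrightarrow>
    x \<in> seeker_moves X r \<sigma> x c \<longleftrightarrow> y \<in> seeker_moves X r \<sigma> y c"
  unfolding membership_code_def by (metis restrict_apply')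

lemma card_of_topspace_ordLeq:
  assumes r: "Well_order r" and "seeker_wins X r"
  shows "|topspace X| \<le>o ctwo ^c r"
proof -
  obtain \<sigma> where \<sigma>: "winning_seeker_strategy X r \<sigma>"
    using assms(2) unfolding seeker_wins_def by blast
  have "inj_on (membership_code X r \<sigma> (Field r)) (topspace X)"
  proof (rule inj_onI, rule ccontr)
    fix x y
    assume xy: "x \<in> topspace X" "y \<in> topspace X" "x \<noteq> y"
      and "membership_code X r \<sigma> (Field r) x = membership_code X r \<sigma> (Field r) y"
    then have same: "x \<in> seeker_moves X r \<sigma> x c \<longleftrightarrow> y \<in> seeker_moves X r \<sigma> y c" if "c \<in> Field r" for c
      using that membership_code_eqD by metis
    obtain a where a: "a \<in> Field r" "x \<in> seeker_moves X r \<sigma> x a \<longleftrightarrow> y \<notin> seeker_moves X r \<sigma> x a"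
      using seeker_moves_separate[OF r \<sigma> xy] by blast
    \<comment> \<open>With all answers equal, both plays use the same set at the separating stage,
      yet it contains exactly one of the points, so the answers there must differ.\<close>
    have "seeker_moves X r \<sigma> x a = seeker_moves X r \<sigma> y a"
      using same by (intro seeker_moves_cong[OF r]) (auto simp: underS_def Field_def)
    then show False
      using a same by metis
  qed
  then show ?thesis
    unfolding ctwo_cexp_eq using membership_code_in_Func
    by (intro card_of_ordLeqI) auto
qed

lemma t0_pseudoweight_ordLeq_two_pow_less:
  assumes r: "Well_order r" and "seeker_wins X r" and inf: "infinite (topspace X)"
  shows "t0_pseudoweight X \<le>o two_pow_less r"
proof -
  let ?k = "two_pow_less r"
  obtain \<sigma> where \<sigma>: "winning_seeker_strategy X r \<sigma>"
    using assms(2) unfolding seeker_wins_def by blast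
  then have strat: "seeker_strategy X r \<sigma>"
    by (simp add: winning_seeker_strategy_def)
  have k: "Card_order ?k"
    by (rule two_pow_less(1)[OF r])
  \<comment> \<open>A finite length would allow only finitely many answer sequences, hence finitely
    many points by the first bound.\<close>
  have "infinite (Field r)"
  proof
    assume "finite (Field r)"
    then have "finite (Func (Field r) (UNIV :: bool set))"
      by (simp add: finite_Func_bool)
    then show False
      using card_of_topspace_ordLeq[OF assms(1,2)] inf
      by (simp add: ctwo_cexp_eq card_of_ordLeq_finite)
  qed
  then have inf_k: "infinite (Field ?k)"
    using card_of_Field_ordLeq_two_pow_less[OF r] k
    by (metis card_of_ordLeq_infinite card_of_Field_ordIso ordIso_symmetric ordLeq_ordIso_trans)
  \<comment> \<open>All open sets the Seeker can reach at stage \<open>a\<close> against Hiders that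
    keep a point. Only answers strictly before \<open>a\<close> matter, which gives the weak power
    instead of \<open>ctwo ^c r\<close>.\<close>
  define M where "M a = (\<lambda>x. seeker_moves X r \<sigma> x a) ` topspace X" for a
  have "|M a| \<le>o ?k" if a: "a \<in> Field r" for a
  proof -
    let ?c = "membership_code X r \<sigma> (underS r a)"
    have "|M a| \<le>o |?c ` topspace X|"
      unfolding M_def
      by (rule card_of_image_ordLeq_image) (auto intro!: seeker_moves_cong[OF r] dest: membership_code_eqD)
    also have "|?c ` topspace X| \<le>o |Func (underS r a) (UNIV :: bool set)|"
      by (rule card_of_mono1) (auto intro: membership_code_in_Func)
    also have "|Func (underS r a) (UNIV :: bool set)| \<le>o ?k"
      using two_pow_less(2)[OF r a] by (simp add: ctwo_cexp_eq Field_Restr_underS[OF r])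
    finally show ?thesis .
  qed
  then have "|\<Union>a\<in>Field r. M a| \<le>o ?k"
    by (intro card_of_UNION_ordLeq_infinite_Field inf_k k card_of_Field_ordLeq_two_pow_less[OF r] ballI)
  then show ?thesis
  proof (rule t0_pseudoweight_separating[OF k inf_k])
    fix U assume "U \<in> (\<Union>a\<in>Field r. M a)"
    then show "openin X U"
      using seeker_moves_play(1)[OF r strat] by (auto simp: M_def game_play_def)
  next
    fix x y assume xy: "x \<in> topspace X" "y \<in> topspace X" "x \<noteq> y"
    obtain a where a: "a \<in> Field r" "x \<in> seeker_moves X r \<sigma> x a \<longleftrightarrow> y \<notin> seeker_moves X r \<sigma> x a"
      using seeker_moves_separate[OF r \<sigma> xy] by blast
    moreover have "seeker_moves X r \<sigma> x a \<in> M a"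
      using xy(1) by (simp add: M_def)
    ultimately show "\<exists>U\<in>(\<Union>a\<in>Field r. M a). x \<in> U \<longleftrightarrow> y \<notin> U"
      by blast
  qed
qed

text \<open>Enumerating the finitely many open sets wins a game of finite length. In the
  contrapositive, length omega forces an infinite space.\<close>

lemma finite_Field_ps:
  assumes "t0_space X" "finite (topspace X)"
  shows "finite (Field (ps X))"
proof -
  obtain r where r: "well_order_on {U. openin X U} r"
    using well_order_on by blast
  then have wo: "Well_order r" "Field r = {U. openin X U}"
    using well_order_on_Well_order[OF r] by auto
  have "{U. openin X U} \<subseteq> Pow (topspace X)"
    by (auto dest: openin_subset)
  then have "finite (Field r)"
    using assms(2) wo(2) by (metis finite_Pow_iff finite_subset)
  moreover have "ps X \<le>o r"
    using ps_least[OF assms(1) wo(1) seeker_wins_enumerate[OF assms(1) r]] .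
  then have "|Field (ps X)| \<le>o |Field r|"
    by (rule card_of_mono2)
  ultimately show ?thesis
    by (metis card_of_ordLeq_finite)
qed

theorem theorem2p1:
  fixes X :: "'a topology"
  assumes "t0_space X"
  shows "|topspace X| \<le>o ctwo ^c ps X
    \<and> (infinite (topspace X) \<longrightarrow> t0_pseudoweight X \<le>o two_pow_less (ps X))
    \<and> (ps X =o natLeq \<longrightarrow> t0_pseudoweight X =o natLeq)"
proof (intro conjI impI)
  note r = ps[OF assms]
  show "|topspace X| \<le>o ctwo ^c ps X"
    by (rule card_of_topspace_ordLeq[OF r])
  show b: "t0_pseudoweight X \<le>o two_pow_less (ps X)" if "infinite (topspace X)"
    by (rule t0_pseudoweight_ordLeq_two_pow_less[OF r that])
  assume omega: "ps X =o natLeq"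
  then have "|Field (ps X)| =o |UNIV :: nat set|"
    using card_of_cong Field_natLeq by metis
  then have inf: "infinite (topspace X)"
    using finite_Field_ps[OF assms] card_of_ordIso_finite infinite_UNIV_nat by blast
  \<comment> \<open>The upper bound is the weak power at omega; the lower bound comes from the
    infinitude of every base of a T0 topology on an infinite space.\<close>
  have "t0_pseudoweight X \<le>o natLeq"
    using b[OF inf] two_pow_less_natLeq[OF r(1) omega] by (rule ordLeq_transitive)
  then show "t0_pseudoweight X =o natLeq"
    using natLeq_ordLeq_t0_pseudoweight[OF assms inf] by (simp add: ordIso_iff_ordLeq)
qed

end
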